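(* Let $\widetilde{V}:\mathbb{R}\to\delta_1\subset\mathfrak{su}(2)$ be a sub-Riemannian Lie quadratic, i.e. a smooth function satisfying $$\dddot{\widetilde{V}}=\big[[\dot{\widetilde{V}},\widetilde{V}],\widetilde{V}\big]+[\widetilde{\mathcal{C}},\widetilde{V}],$$ where $\delta_1=\mathrm{span}\{\frac{i}{\sqrt2}\sigma_1,\frac{i}{\sqrt2}\sigma_2\}$ and $\widetilde{\mathcal{C}}=C\frac{i}{\sqrt2}\sigma_3$ with $C\in\mathbb{R}$. Suppose $\widetilde{V}(t)\ne0$ for all $t$ and that the constant $c_1=\langle\ddot{\widetilde{V}},\widetilde{V}\rangle-\frac12\langle\dot{\widetilde{V}},\dot{\widetilde{V}}\rangle$ is positive. Then both limits $$\alpha_{\pm}(\widetilde{V})=\lim_{t\to\pm\infty}\frac{\widetilde{V}(t)}{\|\widetilde{V}(t)\|}$$ exist.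
   Context: $\sigma_1,\sigma_2,\sigma_3$ are the Pauli matrices. The inner product on $\mathfrak{su}(2)$ is the bi-invariant one $\langle X,Y\rangle=-\mathrm{tr}(XY)$, for which $\frac{i}{\sqrt2}\sigma_1,\frac{i}{\sqrt2}\sigma_2,\frac{i}{\sqrt2}\sigma_3$ are orthonormal, and $\|X\|=\langle X,X\rangle^{1/2}$. The quantity $\langle\ddot{\widetilde{V}},\widetilde{V}\rangle-\frac12\langle\dot{\widetilde{V}},\dot{\widetilde{V}}\rangle$ is constant in $t$ for any sub-Riemannian Lie quadratic. *)

theory Defs
  imports "HOL-Analysis.Analysis"
begin

type_synonym cmat2 = "complex^2^2"

definition pauli1 :: cmat2 where
  "pauli1 = vector [vector [0, 1], vector [1, 0]]"

definition pauli2 :: cmat2 where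
  "pauli2 = vector [vector [0, - \<i>], vector [\<i>, 0]]"

definition pauli3 :: cmat2 where
  "pauli3 = vector [vector [1, 0], vector [0, - 1]]"

definition cscale :: "complex \<Rightarrow> cmat2 \<Rightarrow> cmat2" where
  "cscale c A = (\<chi> i j. c * A $ i $ j)"

definition e1 :: cmat2 where "e1 = cscale (\<i> / sqrt 2) pauli1"
definition e2 :: cmat2 where "e2 = cscale (\<i> / sqrt 2) pauli2"
definition e3 :: cmat2 where "e3 = cscale (\<i> / sqrt 2) pauli3"

definition su2 :: "cmat2 set" where
  "su2 = {X. (\<chi> i j. cnj (X $ j $ i)) = - X \<and> trace X = 0}"

definition lie_bracket :: "cmat2 \<Rightarrow> cmat2 \<Rightarrow> cmat2" where
  "lie_bracket X Y = X ** Y - Y ** X"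

text \<open>On \<open>su2\<close> the trace below is real, so taking the real part only fixes the type
  (see \<open>su2_inner_complex\<close>).\<close>

definition su2_inner :: "cmat2 \<Rightarrow> cmat2 \<Rightarrow> real" where
  "su2_inner X Y = - Re (trace (X ** Y))"

definition su2_norm :: "cmat2 \<Rightarrow> real" where
  "su2_norm X = sqrt (su2_inner X X)"

text \<open>\<open>span\<close> is the real linear span.\<close>

definition delta1 :: "cmat2 set" where
  "delta1 = span {e1, e2}"

definition vderiv :: "nat \<Rightarrow> (real \<Rightarrow> 'a::real_normed_vector) \<Rightarrow> real \<Rightarrow> 'a" where
  "vderiv k f = ((\<lambda>g t. vector_derivative g (at t)) ^^ k) f"

definition smooth_curve :: "(real \<Rightarrow> 'a::real_normed_vector) \<Rightarrow> bool" where
  "smooth_curve f \<longleftrightarrow> (\<forall>k t. vderiv k f differentiable (at t))"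

definition sr_lie_quadratic :: "real \<Rightarrow> (real \<Rightarrow> cmat2) \<Rightarrow> bool" where
  "sr_lie_quadratic C V \<longleftrightarrow>
     smooth_curve V \<and> (\<forall>t. V t \<in> delta1) \<and>
     (\<forall>t. vderiv 3 V t =
        lie_bracket (lie_bracket (vderiv 1 V t) (V t)) (V t) + lie_bracket (C *\<^sub>R e3) (V t))"

definition first_integral :: "(real \<Rightarrow> cmat2) \<Rightarrow> real \<Rightarrow> real" where
  "first_integral V t =
     su2_inner (vderiv 2 V t) (V t) - (1/2) * su2_inner (vderiv 1 V t) (vderiv 1 V t)"

lemma su2_inner_complex:
  assumes "X \<in> su2" "Y \<in> su2"
  shows "complex_of_real (su2_inner X Y) = - trace (X ** Y)"
proof -
  have h: "cnj (Z $ j $ i) = - (Z $ i $ j)" if "Z \<in> su2" for Z i j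
    using that by (simp add: su2_def vec_eq_iff)
  have "cnj (trace (X ** Y)) = trace (X ** Y)"
    by (simp add: trace_def matrix_matrix_mult_def UNIV_2 h[OF assms(1)] h[OF assms(2)] algebra_simps)
  then show ?thesis
    by (simp add: su2_inner_def complex_eq_iff)
qed

lemmas su2_coords = pauli1_def pauli2_def pauli3_def cscale_def trace_def matrix_matrix_mult_def
  UNIV_2 vec_eq_iff forall_2 e1_def e2_def e3_def

lemma basis_in_su2: "e1 \<in> su2" "e2 \<in> su2" "e3 \<in> su2"
  by (simp_all add: su2_def su2_coords)

lemma subspace_su2: "subspace su2"
  by (auto simp: subspace_def su2_def su2_coords algebra_simps simp flip: scaleR_add_right)

lemma delta1_subset_su2: "delta1 \<subseteq> su2"
  unfolding delta1_def by (rule span_minimal) (auto simp: basis_in_su2 subspace_su2)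

lemma basis_orthonormal:
  "su2_inner e1 e1 = 1" "su2_inner e2 e2 = 1" "su2_inner e3 e3 = 1"
  "su2_inner e1 e2 = 0" "su2_inner e1 e3 = 0" "su2_inner e2 e3 = 0"
  by (simp_all add: su2_inner_def su2_coords flip: of_real_mult)

lemma bounded_bilinear_su2_inner: "bounded_bilinear su2_inner"
proof -
  have "bilinear su2_inner"
    by (auto simp: bilinear_def su2_inner_def trace_def matrix_matrix_mult_def UNIV_2
          algebra_simps intro!: linearI)
  then show ?thesis by (simp add: bilinear_conv_bounded_bilinear)
qed

lemma su2_inner_commute: "su2_inner X Y = su2_inner Y X"
  by (simp add: su2_inner_def trace_mul_sym[of X Y])

lemma su2_inner_lie_bracket: "su2_inner (lie_bracket X Y) Y = 0"
  by (simp add: su2_inner_def lie_bracket_def trace_def matrix_matrix_mult_def UNIV_2 algebra_simps)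

lemma vderiv_has_vector_derivative:
  assumes "smooth_curve f"
  shows "(vderiv k f has_vector_derivative vderiv (Suc k) f t) (at t)"
  using assms by (simp add: smooth_curve_def vector_derivative_works vderiv_def)

lemma first_integral_constant:
  assumes "sr_lie_quadratic C V"
  shows "first_integral V s = first_integral V t"
proof -
  note D = vderiv_has_vector_derivative[of V]
  have sm: "smooth_curve V" using assms by (simp add: sr_lie_quadratic_def)
  have d0: "(V has_vector_derivative vderiv 1 V t) (at t)" for t
    using D[OF sm, of 0 t] by (simp add: vderiv_def)
  have d1: "(vderiv 1 V has_vector_derivative vderiv 2 V t) (at t)" for t
    using D[OF sm, of 1 t] by (simp add: numeral_2_eq_2)
  have d2: "(vderiv 2 V has_vector_derivative vderiv 3 V t) (at t)" for t
    using D[OF sm, of 2 t] by (simp add: eval_nat_numeral)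
  interpret bounded_bilinear su2_inner by (rule bounded_bilinear_su2_inner)
  have z: "su2_inner (vderiv 3 V t) (V t) = 0" for t
    using assms by (simp add: sr_lie_quadratic_def add_left su2_inner_lie_bracket)
  have I: "(first_integral V has_vector_derivative
      (su2_inner (vderiv 2 V t) (vderiv 1 V t) + su2_inner (vderiv 3 V t) (V t))
      - (1/2) * (su2_inner (vderiv 1 V t) (vderiv 2 V t) + su2_inner (vderiv 2 V t) (vderiv 1 V t)))
      (at t)" for t
    unfolding first_integral_def
    by (intro has_vector_derivative_diff has_vector_derivative_mult_right
          has_vector_derivative[OF d2 d0] has_vector_derivative[OF d1 d1])
  have "(first_integral V has_vector_derivative 0) (at t)" for t
    using I[of t] z[of t] by (simp add: su2_inner_commute[of "vderiv (Suc 0) V t"])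
  then show ?thesis
    by (metis DERIV_isconst_all has_real_derivative_iff_has_vector_derivative)
qed

end

theory Submission
  imports Defs
begin

text \<open>Write \<open>V = x e1 + y e2\<close> and \<open>L = x y' - y x'\<close>. The equation of motion becomes
  \<open>z''' = \<i> (D - 2L) z\<close> for \<open>z = x + \<i> y\<close> and \<open>D = - sqrt 2 C\<close>, and \<open>|z''|\<^sup>2 + 2 (L - D/2)\<^sup>2\<close> is a second
  constant of the motion, so \<open>L\<close> is bounded. On the other hand \<open>(|z|\<^sup>2)'' = 2 c1 + 3 |z'|\<^sup>2\<close>,
  so \<open>|z|\<^sup>2\<close> grows at least quadratically when \<open>c1 > 0\<close>. The unit vector \<open>z / |z|\<close> moves with
  speed \<open>|L| / |z|\<^sup>2\<close>, which is therefore integrable at \<open>\<plusminus>\<infinity>\<close>.\<close>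

section \<open>Limits and growth from derivative bounds in one real variable\<close>

text \<open>From \<open>T\<close> on, \<open>f t - K / t\<close> is nondecreasing and
  \<open>f t + K / t\<close> is nonincreasing. The first lies below the second, hence is bounded
  above and tends to its supremum; the gap \<open>K / t\<close> vanishes at infinity.\<close>

lemma convergent_at_top_of_deriv_inverse_square:
  fixes f f' :: "real \<Rightarrow> real"
  assumes der: "\<And>t. (f has_real_derivative f' t) (at t)"
    and T: "T > 0" and bound: "\<And>t. t \<ge> T \<Longrightarrow> \<bar>f' t\<bar> \<le> K / t\<^sup>2"
  shows "\<exists>l. (f \<longlongrightarrow> l) at_top"
proof -
  define g where "g t = f t - K / t" for t
  have K: "K \<ge> 0"
    \<comment> \<open>A negative \<open>K\<close> would make the bound at \<open>t = T\<close>
      negative, although it dominates an absolute value.\<close>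
    using bound[of T] T by (smt (verit) divide_neg_pos zero_less_power order_refl)
  have g_mono: "g s \<le> g t" if "T \<le> s" "s \<le> t" for s t
  proof (rule DERIV_nonneg_imp_nondecreasing[OF that(2)])
    fix r assume "s \<le> r" "r \<le> t"
    then have r: "r \<ge> T" "r > 0" using that T by auto
    have "(g has_real_derivative f' r + K / r\<^sup>2) (at r)"
      unfolding g_def using r by (auto intro!: derivative_eq_intros der simp: power2_eq_square)
    then show "\<exists>D. (g has_real_derivative D) (at r) \<and> D \<ge> 0"
      using bound[OF r(1)] by (intro exI[of _ "f' r + K / r\<^sup>2"]) auto
  qed
  have h_mono: "f t + K / t \<le> f s + K / s" if "T \<le> s" "s \<le> t" for s t
  proof (rule DERIV_nonpos_imp_nonincreasing[OF that(2)])
    fix r assume "s \<le> r" "r \<le> t"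
    then have r: "r \<ge> T" "r > 0" using that T by auto
    have "((\<lambda>t. f t + K / t) has_real_derivative f' r - K / r\<^sup>2) (at r)"
      using r by (auto intro!: derivative_eq_intros der simp: power2_eq_square)
    then show "\<exists>D. ((\<lambda>t. f t + K / t) has_real_derivative D) (at r) \<and> D \<le> 0"
      using bound[OF r(1)] by (intro exI[of _ "f' r - K / r\<^sup>2"]) auto
  qed
  have g_le: "g t \<le> f T + K / T" if "t \<ge> T" for t
  proof -
    have "K / t \<ge> 0" using K T that by simp
    then show ?thesis using h_mono[OF order_refl that] by (simp add: g_def)
  qed
  then have bdd: "bdd_above (g ` {T..})" by (auto intro!: bdd_aboveI)
  have "(g \<longlongrightarrow> (SUP t\<in>{T..}. g t)) at_top"
  proof (rule increasing_tendsto)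
    show "\<forall>\<^sub>F t in at_top. g t \<le> (SUP t\<in>{T..}. g t)"
      using eventually_ge_at_top[of T] by eventually_elim (auto intro: cSUP_upper bdd)
  next
    fix y assume "y < (SUP t\<in>{T..}. g t)"
    then obtain s where s: "s \<ge> T" "y < g s"
      using less_cSUP_iff[OF _ bdd, of y] by auto
    show "\<forall>\<^sub>F t in at_top. y < g t"
      using eventually_ge_at_top[of s] by eventually_elim (use s g_mono in force)
  qed
  moreover have "((\<lambda>t. K / t) \<longlongrightarrow> 0) at_top"
    by (intro real_tendsto_divide_at_top[OF tendsto_const filterlim_ident])
  ultimately have "((\<lambda>t. g t + K / t) \<longlongrightarrow> (SUP t\<in>{T..}. g t) + 0) at_top"
    by (rule tendsto_add)
  then show ?thesis by (auto simp: g_def)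
qed

lemma convergent_at_infinities_of_deriv_inverse_square:
  fixes f f' :: "real \<Rightarrow> real"
  assumes der: "\<And>t. (f has_real_derivative f' t) (at t)"
    and T: "T > 0" and bound: "\<And>t. \<bar>t\<bar> \<ge> T \<Longrightarrow> \<bar>f' t\<bar> \<le> K / t\<^sup>2"
  shows "(\<exists>l. (f \<longlongrightarrow> l) at_top) \<and> (\<exists>l. (f \<longlongrightarrow> l) at_bot)"
proof
  show "\<exists>l. (f \<longlongrightarrow> l) at_top"
    using convergent_at_top_of_deriv_inverse_square[OF der T, of K] bound by auto
  have "((\<lambda>t. f (- t)) has_real_derivative - f' (- t)) (at t)" for t
    using DERIV_chain2[where f = f and g = uminus, OF der DERIV_minus[OF DERIV_ident]] by simp
  then have "\<exists>l. ((\<lambda>t. f (- t)) \<longlongrightarrow> l) at_top"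
    by (rule convergent_at_top_of_deriv_inverse_square[OF _ T, of _ _ K])
       (use bound[of "- _"] in auto)
  then show "\<exists>l. (f \<longlongrightarrow> l) at_bot"
    by (simp add: filterlim_at_bot_mirror)
qed

text \<open>Subtracting \<open>c * t\<^sup>2\<close> leaves a convex function, which lies above its
  tangent at 0. This handles both time directions at once. Half of the quadratic term is given up to
  absorb the affine function \<open>N 0 + N' 0 * t\<close>.\<close>

lemma quadratic_growth_of_second_deriv_ge:
  fixes N N' N'' :: "real \<Rightarrow> real"
  assumes d: "\<And>t. (N has_real_derivative N' t) (at t)"
    and dd: "\<And>t. (N' has_real_derivative N'' t) (at t)"
    and ge: "\<And>t. N'' t \<ge> 2 * c" and c: "c > 0"
  shows "\<exists>T>0. \<forall>t. \<bar>t\<bar> \<ge> T \<longrightarrow> N t \<ge> c / 2 * t\<^sup>2"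
proof -
  define F where "F t = N t - c * t\<^sup>2" for t
  have F1: "(F has_real_derivative N' t - 2 * c * t) (at t)" for t
    unfolding F_def by (auto intro!: derivative_eq_intros d)
  have F2: "((\<lambda>t. N' t - 2 * c * t) has_real_derivative N'' t - 2 * c) (at t)" for t
    by (auto intro!: derivative_eq_intros dd)
  have "convex_on UNIV F"
    using ge by (intro f''_ge0_imp_convex[OF _ F1 F2]) auto
  then have tangent: "F t - F 0 \<ge> (N' 0 - 2 * c * 0) * (t - 0)" for t
    using F1[of 0] by (intro convex_on_imp_above_tangent[where A = UNIV]) auto
  \<comment> \<open>The fraction makes \<open>c / 2 * T\<close> dominate both tangent coefficients;
    the summand 1 gives \<open>1 \<le> \<bar>t\<bar>\<close>, so that the constant
    \<open>\<bar>N 0\<bar>\<close> is at most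
    \<open>\<bar>N 0\<bar> * \<bar>t\<bar>\<close>.\<close>
  define T where "T = 1 + 2 * (\<bar>N 0\<bar> + \<bar>N' 0\<bar>) / c"
  have T: "T \<ge> 1" "c / 2 * T \<ge> \<bar>N 0\<bar> + \<bar>N' 0\<bar>"
    using c by (auto simp: T_def field_simps)
  have "N t \<ge> c / 2 * t\<^sup>2" if t: "\<bar>t\<bar> \<ge> T" for t
  proof -
    have "\<bar>N 0\<bar> + \<bar>N' 0\<bar> \<le> c / 2 * \<bar>t\<bar>"
      using T(2) mult_left_mono[OF t, of "c / 2"] c by linarith
    from mult_right_mono[OF this, of "\<bar>t\<bar>"]
    have "\<bar>N 0\<bar> * \<bar>t\<bar> + \<bar>N' 0\<bar> * \<bar>t\<bar> \<le> c / 2 * t\<^sup>2"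
      by (simp add: algebra_simps power2_eq_square flip: abs_mult)
    moreover have "\<bar>N 0\<bar> \<le> \<bar>N 0\<bar> * \<bar>t\<bar>"
      using t T(1) mult_left_mono[of 1 "\<bar>t\<bar>" "\<bar>N 0\<bar>"] by simp
    moreover have "\<bar>N' 0 * t\<bar> = \<bar>N' 0\<bar> * \<bar>t\<bar>" by (rule abs_mult)
    moreover have "N t \<ge> N 0 + N' 0 * t + c * t\<^sup>2"
      using tangent[of t] by (simp add: F_def)
    ultimately show ?thesis by (simp add: field_simps) linarith
  qed
  then show ?thesis using T(1) by (intro exI[of _ T]) auto
qed

section \<open>Rotation of the unit vector of a plane curve\<close>

text \<open>In polar coordinates this is the derivative \<open>- sin \<theta> * \<theta>'\<close> of
  \<open>cos \<theta>\<close>, with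
  \<open>\<theta>' = (x * y' - y * x') / (x\<^sup>2 + y\<^sup>2)\<close>; the minus sign is absorbed
  by the order of the difference.\<close>

lemma has_real_derivative_unit_component:
  fixes x y x' y' :: "real \<Rightarrow> real"
  assumes dx: "(x has_real_derivative x' t) (at t)" and dy: "(y has_real_derivative y' t) (at t)"
    and pos: "(x t)\<^sup>2 + (y t)\<^sup>2 > 0"
  shows "((\<lambda>t. x t / sqrt ((x t)\<^sup>2 + (y t)\<^sup>2)) has_real_derivative
    y t / sqrt ((x t)\<^sup>2 + (y t)\<^sup>2) * ((x' t * y t - x t * y' t) / ((x t)\<^sup>2 + (y t)\<^sup>2))) (at t)"
proof -
  define s where "s = sqrt ((x t)\<^sup>2 + (y t)\<^sup>2)"
  have s: "s > 0" "(x t)\<^sup>2 + (y t)\<^sup>2 = s\<^sup>2" using pos by (auto simp: s_def)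
  have "((\<lambda>t. x t / sqrt ((x t)\<^sup>2 + (y t)\<^sup>2)) has_real_derivative
      (x' t * s - x t * ((2 * x t * x' t + 2 * y t * y' t) * (inverse s / 2))) / (s * s)) (at t)"
    unfolding s_def using pos
    by (auto intro!: derivative_eq_intros dx dy)
  also have "(x' t * s - x t * ((2 * x t * x' t + 2 * y t * y' t) * (inverse s / 2))) / (s * s)
      = (x' t * s\<^sup>2 - x t * (x t * x' t + y t * y' t)) / (s * s\<^sup>2)"
    using s(1) by (simp add: field_simps power2_eq_square)
  \<comment> \<open>Once \<open>s\<^sup>2\<close> is expanded in the numerator, the terms with
    \<open>x\<^sup>2 * x'\<close> cancel and a factor \<open>y\<close> comes out.\<close>
  also have "\<dots> = y t / s * ((x' t * y t - x t * y' t) / s\<^sup>2)"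
    unfolding s(2)[symmetric] times_divide_times_eq by (simp add: algebra_simps power2_eq_square)
  finally show ?thesis unfolding s(2) by (simp add: s_def)
qed

text \<open>The other component of the unit vector has modulus at most 1, so the speed is at most
  the angular momentum over the squared radius. Quadratic growth turns this into an inverse-square
  bound.\<close>

lemma unit_component_convergent:
  fixes x y x' y' :: "real \<Rightarrow> real"
  assumes dx: "\<And>t. (x has_real_derivative x' t) (at t)"
    and dy: "\<And>t. (y has_real_derivative y' t) (at t)"
    and pos: "\<And>t. (x t)\<^sup>2 + (y t)\<^sup>2 > 0"
    and growth: "\<And>t. \<bar>t\<bar> \<ge> T \<Longrightarrow> (x t)\<^sup>2 + (y t)\<^sup>2 \<ge> c * t\<^sup>2" and "T > 0" "c > 0"
    and bound: "\<And>t. \<bar>x t * y' t - y t * x' t\<bar> \<le> B"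
  shows "(\<exists>l. ((\<lambda>t. x t / sqrt ((x t)\<^sup>2 + (y t)\<^sup>2)) \<longlongrightarrow> l) at_top) \<and>
         (\<exists>l. ((\<lambda>t. x t / sqrt ((x t)\<^sup>2 + (y t)\<^sup>2)) \<longlongrightarrow> l) at_bot)"
proof (rule convergent_at_infinities_of_deriv_inverse_square
    [OF has_real_derivative_unit_component[where x' = x' and y' = y', OF dx dy pos] \<open>T > 0\<close>])
  fix t :: real assume t: "\<bar>t\<bar> \<ge> T"
  let ?N = "(x t)\<^sup>2 + (y t)\<^sup>2"
  have 1: "\<bar>y t / sqrt ?N\<bar> \<le> 1"
    using pos[of t] by (simp add: abs_divide real_le_rsqrt)
  have "\<bar>x' t * y t - x t * y' t\<bar> \<le> B"
    using bound[of t] by (simp add: mult.commute abs_minus_commute)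
  then have 2: "\<bar>(x' t * y t - x t * y' t) / ?N\<bar> \<le> B / (c * t\<^sup>2)"
    using growth[OF t] t \<open>T > 0\<close> \<open>c > 0\<close> unfolding abs_divide by (intro frac_le) auto
  have "\<bar>y t / sqrt ?N * ((x' t * y t - x t * y' t) / ?N)\<bar> \<le> 1 * (B / (c * t\<^sup>2))"
    unfolding abs_mult by (intro mult_mono 1 2) auto
  then show "\<bar>y t / sqrt ?N * ((x' t * y t - x t * y' t) / ?N)\<bar> \<le> B / c / t\<^sup>2"
    by simp
qed

section \<open>The planar third-order system; the index \<open>k\<close> counts derivatives\<close>

text \<open>The derivative of \<open>\<bar>z''\<bar>\<^sup>2\<close> is
  \<open>2 * (D - 2 * L) * L'\<close>, because \<open>L' = x * y'' - y * x''\<close>. This cancels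
  the derivative of \<open>2 * (L - D / 2)\<^sup>2\<close>, and a conserved sum of squares bounds
  each summand.\<close>

lemma planar_angular_momentum_bounded:
  fixes x y :: "nat \<Rightarrow> real \<Rightarrow> real"
  assumes dx: "\<And>k t. (x k has_real_derivative x (Suc k) t) (at t)"
    and dy: "\<And>k t. (y k has_real_derivative y (Suc k) t) (at t)"
    and L: "\<And>t. L t = x 0 t * y 1 t - y 0 t * x 1 t"
    and x3: "\<And>t. x 3 t = - (D - 2 * L t) * y 0 t"
    and y3: "\<And>t. y 3 t = (D - 2 * L t) * x 0 t"
  shows "\<exists>B. \<forall>t. \<bar>L t\<bar> \<le> B"
proof -
  have d: "(x 0 has_real_derivative x 1 t) (at t)" "(y 0 has_real_derivative y 1 t) (at t)"
      "(x 1 has_real_derivative x 2 t) (at t)" "(y 1 has_real_derivative y 2 t) (at t)"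
      "(x 2 has_real_derivative x 3 t) (at t)" "(y 2 has_real_derivative y 3 t) (at t)" for t
    using dx[of _ t] dy[of _ t] by (metis One_nat_def numeral_2_eq_2 numeral_3_eq_3)+
  define E where "E t = (x 2 t)\<^sup>2 + (y 2 t)\<^sup>2 + 2 * (L t - D / 2)\<^sup>2" for t
  have L': "(L has_real_derivative x 0 t * y 2 t - y 0 t * x 2 t) (at t)" for t
    unfolding L[abs_def] by (auto intro!: derivative_eq_intros d simp del: One_nat_def)
  have "(E has_real_derivative 2 * x 2 t * x 3 t + 2 * y 2 t * y 3 t
      + 4 * (L t - D / 2) * (x 0 t * y 2 t - y 0 t * x 2 t)) (at t)" for t
    unfolding E_def by (auto intro!: derivative_eq_intros d L' simp del: One_nat_def)
  then have "(E has_real_derivative 0) (at t)" for t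
    unfolding x3 y3 by (rule back_subst) (simp add: algebra_simps)
  then have E: "E t = E 0" for t
    using DERIV_isconst_all by blast
  have "\<bar>L t\<bar> \<le> sqrt (E 0) + \<bar>D / 2\<bar>" for t
  proof -
    have "\<bar>L t - D / 2\<bar> \<le> sqrt (E 0)"
      unfolding E[of t, symmetric] by (rule real_le_rsqrt) (simp add: E_def)
    then show ?thesis by linarith
  qed
  then show ?thesis by blast
qed

lemma planar_directions_convergent:
  fixes x y :: "nat \<Rightarrow> real \<Rightarrow> real"
  assumes dx: "\<And>k t. (x k has_real_derivative x (Suc k) t) (at t)"
    and dy: "\<And>k t. (y k has_real_derivative y (Suc k) t) (at t)"
    and L: "\<And>t. L t = x 0 t * y 1 t - y 0 t * x 1 t"
    and x3: "\<And>t. x 3 t = - (D - 2 * L t) * y 0 t"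
    and y3: "\<And>t. y 3 t = (D - 2 * L t) * x 0 t"
    and pos: "\<And>t. (x 0 t)\<^sup>2 + (y 0 t)\<^sup>2 > 0"
    and c: "\<And>t. x 2 t * x 0 t + y 2 t * y 0 t - ((x 1 t)\<^sup>2 + (y 1 t)\<^sup>2) / 2 = c" "c > 0"
  shows "(\<exists>l. ((\<lambda>t. x 0 t / sqrt ((x 0 t)\<^sup>2 + (y 0 t)\<^sup>2)) \<longlongrightarrow> l) at_top) \<and>
         (\<exists>l. ((\<lambda>t. x 0 t / sqrt ((x 0 t)\<^sup>2 + (y 0 t)\<^sup>2)) \<longlongrightarrow> l) at_bot)" (is ?thesis1)
    and "(\<exists>l. ((\<lambda>t. y 0 t / sqrt ((x 0 t)\<^sup>2 + (y 0 t)\<^sup>2)) \<longlongrightarrow> l) at_top) \<and>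
         (\<exists>l. ((\<lambda>t. y 0 t / sqrt ((x 0 t)\<^sup>2 + (y 0 t)\<^sup>2)) \<longlongrightarrow> l) at_bot)" (is ?thesis2)
proof -
  have d: "(x 0 has_real_derivative x 1 t) (at t)" "(y 0 has_real_derivative y 1 t) (at t)"
      "(x 1 has_real_derivative x 2 t) (at t)" "(y 1 has_real_derivative y 2 t) (at t)" for t
    using dx[of _ t] dy[of _ t] by (metis One_nat_def numeral_2_eq_2)+
  obtain B where B: "\<bar>x 0 t * y 1 t - y 0 t * x 1 t\<bar> \<le> B" for t
    using planar_angular_momentum_bounded[OF dx dy L x3 y3] unfolding L by blast
  have N1: "((\<lambda>t. (x 0 t)\<^sup>2 + (y 0 t)\<^sup>2) has_real_derivative
      2 * (x 0 t * x 1 t + y 0 t * y 1 t)) (at t)" for t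
    by (auto intro!: derivative_eq_intros d simp del: One_nat_def)
  have N2: "((\<lambda>t. 2 * (x 0 t * x 1 t + y 0 t * y 1 t)) has_real_derivative
      2 * ((x 1 t)\<^sup>2 + x 0 t * x 2 t + (y 1 t)\<^sup>2 + y 0 t * y 2 t)) (at t)" for t
    by (auto intro!: derivative_eq_intros d simp: power2_eq_square simp del: One_nat_def)
  \<comment> \<open>The two sides differ by
    \<open>3 * ((x 1 t)\<^sup>2 + (y 1 t)\<^sup>2)\<close>.\<close>
  have N2_ge: "2 * ((x 1 t)\<^sup>2 + x 0 t * x 2 t + (y 1 t)\<^sup>2 + y 0 t * y 2 t) \<ge> 2 * c" for t
    unfolding c(1)[of t, symmetric] by (simp add: field_simps)
  obtain T where T: "T > 0" "\<And>t. \<bar>t\<bar> \<ge> T \<Longrightarrow> (x 0 t)\<^sup>2 + (y 0 t)\<^sup>2 \<ge> c / 2 * t\<^sup>2"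
    using quadratic_growth_of_second_deriv_ge[OF N1 N2 N2_ge c(2)] by blast
  show ?thesis1
    using unit_component_convergent[OF d(1,2) pos T(2) T(1) _ B] c(2) by simp
  \<comment> \<open>Exchanging the coordinates only changes the sign of the angular momentum, so the
    second component follows from the same lemma.\<close>
  have "\<bar>y 0 t * x 1 t - x 0 t * y 1 t\<bar> \<le> B" for t
    using B[of t] by linarith
  then show ?thesis2
    using unit_component_convergent[OF d(2,1), of T "c / 2" B] pos T c(2)
    by (simp add: add.commute)
qed

section \<open>Brackets and coordinates in su(2)\<close>

lemma lie_bracket_linear:
  "lie_bracket (A + B) Z = lie_bracket A Z + lie_bracket B Z"
  "lie_bracket Z (A + B) = lie_bracket Z A + lie_bracket Z B"
  "lie_bracket (r *\<^sub>R A) Z = r *\<^sub>R lie_bracket A Z"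
  "lie_bracket Z (r *\<^sub>R A) = r *\<^sub>R lie_bracket Z A"
  by (simp_all add: lie_bracket_def vec_eq_iff matrix_matrix_mult_def UNIV_2 algebra_simps)

text \<open>The factor \<open>sqrt 2\<close> and the sign come from the Pauli relation
  \<open>[\<sigma>1, \<sigma>2] = 2 * \<i> * \<sigma>3\<close> and its cyclic shifts, after scaling
  each matrix by \<open>\<i> / sqrt 2\<close>.\<close>

lemma lie_bracket_basis:
  "lie_bracket e1 e1 = 0" "lie_bracket e2 e2 = 0"
  "lie_bracket e1 e2 = - sqrt 2 *\<^sub>R e3" "lie_bracket e2 e1 = sqrt 2 *\<^sub>R e3"
  "lie_bracket e3 e1 = - sqrt 2 *\<^sub>R e2" "lie_bracket e3 e2 = sqrt 2 *\<^sub>R e1"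
  by (simp_all add: lie_bracket_def su2_coords complex_eq_iff real_div_sqrt field_simps)

text \<open>Two vectors of the plane have their bracket along \<open>e3\<close>, with the signed
  area they span as coefficient. So both terms are brackets of a multiple of \<open>e3\<close> with
  \<open>X\<close>, and such a bracket is a scaled quarter turn of the plane: the result is
  \<open>\<i> * w * z\<close> for \<open>z = a + \<i> * b\<close>.\<close>

lemma sr_right_hand_side:
  fixes a b a' b' C :: real
  defines "X \<equiv> a *\<^sub>R e1 + b *\<^sub>R e2" and "Y \<equiv> a' *\<^sub>R e1 + b' *\<^sub>R e2"
    and "w \<equiv> - sqrt 2 * C - 2 * (a * b' - b * a')"
  shows "lie_bracket (lie_bracket Y X) X + lie_bracket (C *\<^sub>R e3) X
    = (- w * b) *\<^sub>R e1 + (w * a) *\<^sub>R e2"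
proof -
  have comm: "lie_bracket Y X = (sqrt 2 * (a * b' - b * a')) *\<^sub>R e3"
    unfolding X_def Y_def
    by (simp add: lie_bracket_linear lie_bracket_basis scaleR_add_left[symmetric] mult.commute
        scaleR_minus_left[symmetric] del: scaleR_minus_left) (simp add: algebra_simps)
  have rot: "lie_bracket (r *\<^sub>R e3) X = (r * sqrt 2 * b) *\<^sub>R e1 + (- (r * sqrt 2 * a)) *\<^sub>R e2" for r
    unfolding X_def by (simp add: lie_bracket_linear lie_bracket_basis scaleR_add_right mult_ac)
  have w: "(sqrt 2 * (a * b' - b * a') + C) * sqrt 2 = - w"
    unfolding w_def by (simp add: algebra_simps flip: mult.assoc)
  show ?thesis
    unfolding comm lie_bracket_linear(1)[symmetric] scaleR_add_left[symmetric]
    unfolding rot w by simp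
qed

lemma delta1_expansion:
  assumes "X \<in> delta1"
  shows "X = su2_inner X e1 *\<^sub>R e1 + su2_inner X e2 *\<^sub>R e2"
proof -
  interpret bounded_bilinear su2_inner by (rule bounded_bilinear_su2_inner)
  obtain a b where "X = a *\<^sub>R e1 + b *\<^sub>R e2"
    using assms by (auto simp: delta1_def span_insert algebra_simps)
  then show ?thesis
    by (simp add: add_left scaleR_left basis_orthonormal su2_inner_commute[of e2 e1])
qed

text \<open>Differentiation commutes with the bounded linear maps that give the frame coefficients.
  Hence the expansion of a curve in the plane differentiates to an expansion in the same frame, and
  uniqueness of the derivative identifies the two.\<close>

lemma vderiv_in_delta1:
  assumes "smooth_curve V" "\<And>t. V t \<in> delta1"
  shows "vderiv k V t \<in> delta1"
proof (induction k arbitrary: t)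
  case 0
  then show ?case using assms(2) by (simp add: vderiv_def)
next
  case (Suc k)
  interpret bounded_bilinear su2_inner by (rule bounded_bilinear_su2_inner)
  note D = vderiv_has_vector_derivative[OF assms(1), of k t]
  have "((\<lambda>t. su2_inner (vderiv k V t) e1 *\<^sub>R e1 + su2_inner (vderiv k V t) e2 *\<^sub>R e2)
      has_vector_derivative su2_inner (vderiv (Suc k) V t) e1 *\<^sub>R e1
        + su2_inner (vderiv (Suc k) V t) e2 *\<^sub>R e2) (at t)"
    by (intro has_vector_derivative_add
      bounded_linear.has_vector_derivative[OF bounded_linear_scaleR_left]
      bounded_linear.has_vector_derivative[OF bounded_linear_left] D)
  then have "(vderiv k V has_vector_derivative su2_inner (vderiv (Suc k) V t) e1 *\<^sub>R e1
        + su2_inner (vderiv (Suc k) V t) e2 *\<^sub>R e2) (at t)"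
    using delta1_expansion[OF Suc.IH] by simp
  from vector_derivative_unique_at[OF D this] show ?case
    unfolding delta1_def by (rule ssubst) (intro span_add span_mul span_base; simp)
qed

lemma su2_inner_frame:
  "su2_inner (a *\<^sub>R e1 + b *\<^sub>R e2) (a' *\<^sub>R e1 + b' *\<^sub>R e2) = a * a' + b * b'"
proof -
  interpret bounded_bilinear su2_inner by (rule bounded_bilinear_su2_inner)
  show ?thesis
    by (simp add: add_left add_right scaleR_left scaleR_right basis_orthonormal
        su2_inner_commute[of e2 e1])
qed

section \<open>Transfer of the planar limits to the Lie quadratic\<close>

theorem mainTheorem5:
  fixes V :: "real \<Rightarrow> complex^2^2" and C c1 :: real
  assumes "sr_lie_quadratic C V"
    and "\<And>t. V t \<noteq> 0"
    and "\<And>t. first_integral V t = c1"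
    and "c1 > 0"
  shows "(\<exists>\<alpha>\<^sub>p. ((\<lambda>t. V t /\<^sub>R su2_norm (V t)) \<longlongrightarrow> \<alpha>\<^sub>p) at_top) \<and>
         (\<exists>\<alpha>\<^sub>m. ((\<lambda>t. V t /\<^sub>R su2_norm (V t)) \<longlongrightarrow> \<alpha>\<^sub>m) at_bot)"
proof -
  interpret bounded_bilinear su2_inner by (rule bounded_bilinear_su2_inner)
  have sm: "smooth_curve V" and in_delta1: "V t \<in> delta1"
    and ode: "vderiv 3 V t =
        lie_bracket (lie_bracket (vderiv 1 V t) (V t)) (V t) + lie_bracket (C *\<^sub>R e3) (V t)" for t
    using assms(1) by (auto simp: sr_lie_quadratic_def)
  define x y where "x k t = su2_inner (vderiv k V t) e1"
    and "y k t = su2_inner (vderiv k V t) e2" for k t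
  define L where "L t = x 0 t * y 1 t - y 0 t * x 1 t" for t
  define D where "D = - sqrt 2 * C"
  have V: "vderiv k V t = x k t *\<^sub>R e1 + y k t *\<^sub>R e2" for k t
    unfolding x_def y_def by (intro delta1_expansion vderiv_in_delta1 sm in_delta1)
  have V0: "V t = x 0 t *\<^sub>R e1 + y 0 t *\<^sub>R e2" for t
    using V[of 0] by (simp add: vderiv_def)
  have dx: "(x k has_real_derivative x (Suc k) t) (at t)"
    and dy: "(y k has_real_derivative y (Suc k) t) (at t)" for k t
    unfolding x_def y_def has_real_derivative_iff_has_vector_derivative
    by (intro bounded_linear.has_vector_derivative[OF bounded_linear_left]
        vderiv_has_vector_derivative[OF sm])+
  \<comment> \<open>This is \<open>z''' = \<i> * (D - 2 * L) * z\<close> in real form; pairing it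
    with \<open>e1\<close> and \<open>e2\<close> gives the two scalar equations.\<close>
  have V3: "vderiv 3 V t = (- (D - 2 * L t) * y 0 t) *\<^sub>R e1 + ((D - 2 * L t) * x 0 t) *\<^sub>R e2" for t
    unfolding ode[of t] V[of 1] V0 sr_right_hand_side D_def L_def ..
  have e21: "su2_inner e2 e1 = 0"
    using basis_orthonormal su2_inner_commute[of e2 e1] by simp
  have x3: "x 3 t = - (D - 2 * L t) * y 0 t" and y3: "y 3 t = (D - 2 * L t) * x 0 t" for t
    unfolding x_def[of 3] y_def[of 3] V3
    by (simp_all add: add_left scaleR_left basis_orthonormal e21)
  have pos: "(x 0 t)\<^sup>2 + (y 0 t)\<^sup>2 > 0" for t
    using assms(2)[of t] V0[of t] by (auto simp: sum_power2_gt_zero_iff)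
  have c: "x 2 t * x 0 t + y 2 t * y 0 t - ((x 1 t)\<^sup>2 + (y 1 t)\<^sup>2) / 2 = c1" for t
    using assms(3)[of t] unfolding first_integral_def V V0 su2_inner_frame
    by (simp add: power2_eq_square)
  have normV: "su2_norm (V t) = sqrt ((x 0 t)\<^sup>2 + (y 0 t)\<^sup>2)" for t
    by (simp add: su2_norm_def V0 su2_inner_frame power2_eq_square)
  have unit: "V t /\<^sub>R su2_norm (V t) = (x 0 t / sqrt ((x 0 t)\<^sup>2 + (y 0 t)\<^sup>2)) *\<^sub>R e1
      + (y 0 t / sqrt ((x 0 t)\<^sup>2 + (y 0 t)\<^sup>2)) *\<^sub>R e2" for t
    unfolding normV by (subst V0) (simp add: scaleR_add_right divide_inverse mult.commute)
  \<comment> \<open>The filter is left arbitrary so that one argument serves both ends of the time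
    axis.\<close>
  have combine: "\<exists>\<alpha>. ((\<lambda>t. p t *\<^sub>R e1 + q t *\<^sub>R e2) \<longlongrightarrow> \<alpha>) F"
    if lims: "\<exists>l. (p \<longlongrightarrow> l) F" "\<exists>l. (q \<longlongrightarrow> l) F" for p q :: "real \<Rightarrow> real" and F
  proof -
    obtain l m where "(p \<longlongrightarrow> l) F" "(q \<longlongrightarrow> m) F"
      using lims by blast
    then have "((\<lambda>t. p t *\<^sub>R e1 + q t *\<^sub>R e2) \<longlongrightarrow> l *\<^sub>R e1 + m *\<^sub>R e2) F"
      by (intro tendsto_intros)
    then show ?thesis ..
  qed
  note conv = planar_directions_convergent[OF dx dy L_def x3 y3 pos c assms(4)]
  show ?thesis
    unfolding unit by (intro conjI combine) (use conv in auto)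
qed

end
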